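(* Let $S$ be a commutative semigroup and let $P$ be a downward complete subsemigroup of $\mathcal P(S)$. Then the cancellative elements of the semigroup $P$ are all and only the singletons $\{u\}$ such that $u$ is a cancellative element of $S$; that is, a set $A \in P$ is a cancellative element of $P$ if and only if $A = \{u\}$ for some cancellative element $u$ of $S$.
   Context: All semigroups are written multiplicatively. For a semigroup $S$, $\mathcal P(S)$ (the large power semigroup of $S$) is the semigroup of all non-empty subsets of $S$ under setwise multiplication $XY := \{xy : x \in X,\ y \in Y\}$. A subsemigroup $P$ of $\mathcal P(S)$ is called downward complete if (i) each element of $S$ lies in at least one set $X \in P$, and (ii) every non-empty subset of a set in $P$ is itself in $P$. An element $a$ of a semigroup $T$ is left (resp., right) cancellative if the map $T \to T$, $x \mapsto ax$ (resp., $x \mapsto xa$) is injective, and cancellative if it is both left and right cancellative. Being a cancellative element of $P$ refers to this definition with $T = P$ (equipped with the operation inherited from $\mathcal P(S)$). *)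

theory Defs
  imports "HOL-Library.Set_Algebras"
begin

(* Set_Algebras makes X * Y the setwise product {x * y | x : X, y : Y}, and the type of all
   subsets (including the empty one) a semigroup under it. *)

definition large_power_semigroup :: "'a::semigroup_mult set set"
  where "large_power_semigroup = {X. X \<noteq> {}}"

definition subsemigroup :: "'a::semigroup_mult set \<Rightarrow> 'a set \<Rightarrow> bool"
  where "subsemigroup P T \<longleftrightarrow> P \<subseteq> T \<and> (\<forall>x\<in>P. \<forall>y\<in>P. x * y \<in> P)"

definition downward_complete :: "'a::semigroup_mult set set \<Rightarrow> bool"
  where "downward_complete P \<longleftrightarrow>
    subsemigroup P large_power_semigroup \<and>
    (\<forall>s. \<exists>X\<in>P. s \<in> X) \<and>
    (\<forall>X\<in>P. \<forall>Y. Y \<noteq> {} \<and> Y \<subseteq> X \<longrightarrow> Y \<in> P)"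

(* T is the carrier, closed under multiplication, of the semigroup in which cancellativity is
   meant: T = UNIV for the whole type. Injectivity is only required on T. *)

definition left_cancellative :: "'a::semigroup_mult set \<Rightarrow> 'a \<Rightarrow> bool"
  where "left_cancellative T a \<longleftrightarrow> a \<in> T \<and> inj_on (\<lambda>x. a * x) T"

definition right_cancellative :: "'a::semigroup_mult set \<Rightarrow> 'a \<Rightarrow> bool"
  where "right_cancellative T a \<longleftrightarrow> a \<in> T \<and> inj_on (\<lambda>x. x * a) T"

definition cancellative :: "'a::semigroup_mult set \<Rightarrow> 'a \<Rightarrow> bool"
  where "cancellative T a \<longleftrightarrow> left_cancellative T a \<and> right_cancellative T a"

end

theory Submission
  imports Defs
begin

text \<open>
  Downward completeness puts every singleton into \<open>P\<close>, and \<open>x \<mapsto> {x}\<close> is a homomorphism; so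
  cancellativity of \<open>{u}\<close> in \<open>P\<close> restricts to cancellativity of \<open>u\<close>. Conversely, multiplication
  by \<open>{u}\<close> is taking the image under \<open>x \<mapsto> u * x\<close>, which is injective on sets as soon as it is
  injective on elements.

  The substance is that a cancellative \<open>A \<in> P\<close> has only one element. Otherwise there are
  \<open>a, b \<in> A\<close> with \<open>a * a \<noteq> a * b\<close>: if \<open>x * a = x * x = x * b\<close> for all \<open>x, a, b \<in> A\<close>, then
  \<open>A * {a} = A * {b}\<close>, so \<open>A\<close> would not distinguish the singletons of its own elements.
  Given such \<open>a\<close> and \<open>b\<close>, the element \<open>a * b\<close> is redundant in \<open>A * A\<close>: deleting it leaves a
  nonempty, strictly smaller set of \<open>P\<close> with the same product by \<open>A\<close>
  (lemma \<open>times_Diff_singleton_eq\<close>).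
\<close>

lemma cancellative_iff_left_cancellative:
  fixes a :: "'a::ab_semigroup_mult"
  shows "cancellative T a \<longleftrightarrow> left_cancellative T a"
  by (simp add: cancellative_def left_cancellative_def right_cancellative_def mult.commute)

lemma singleton_times_eq_image: "{u} * X = (\<lambda>x. u * x) ` X"
  by (auto simp: set_times_def)

lemma downward_complete_singleton:
  assumes "downward_complete P"
  shows "{x} \<in> P"
  using assms unfolding downward_complete_def by (metis empty_subsetI insert_not_empty insert_subset)

lemma downward_complete_times:
  assumes "downward_complete P" "X \<in> P" "Y \<in> P"
  shows "X * Y \<in> P"
  using assms by (simp add: downward_complete_def subsemigroup_def)

lemma downward_complete_subset:
  assumes "downward_complete P" "X \<in> P" "Y \<subseteq> X" "Y \<noteq> {}"
  shows "Y \<in> P"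
  using assms by (simp add: downward_complete_def)

lemma downward_complete_nonempty:
  assumes "downward_complete P" "X \<in> P"
  shows "X \<noteq> {}"
  using assms by (auto simp: downward_complete_def subsemigroup_def large_power_semigroup_def)

text \<open>
  A product \<open>x * (a * b)\<close> with the deleted element equals \<open>a * (b * x)\<close>, which is a product
  with a surviving element unless \<open>b * x = a * b\<close>. In that case it equals
  \<open>a * (a * b) = b * (a * a)\<close>, and \<open>a * a\<close> survives by assumption.
\<close>
lemma times_Diff_singleton_eq:
  fixes A :: "'a::ab_semigroup_mult set"
  assumes "a \<in> A" "b \<in> A" "a * a \<noteq> a * b"
  shows "A * (A * A - {a * b}) = A * (A * A)"
proof
  show "A * (A * A) \<subseteq> A * (A * A - {a * b})"
  proof
    fix z assume "z \<in> A * (A * A)"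
    then obtain x y where z: "z = x * y" "x \<in> A" "y \<in> A * A"
      by (auto elim: set_times_elim)
    consider "y \<noteq> a * b" | "y = a * b" "b * x \<noteq> a * b" | "y = a * b" "b * x = a * b"
      by blast
    then show "z \<in> A * (A * A - {a * b})"
    proof cases
      case 1
      then show ?thesis using z by (auto intro: set_times_intro)
    next
      case 2
      then have "z = a * (b * x)" using z by (simp add: ac_simps)
      moreover have "b * x \<in> A * A - {a * b}"
        using 2 assms z by (auto intro: set_times_intro)
      ultimately show ?thesis using assms by (auto intro: set_times_intro)
    next
      case 3
      have "z = a * (b * x)" using 3 z by (simp add: ac_simps)
      also have "\<dots> = b * (a * a)" using 3 by (simp add: ac_simps)
      finally have "z = b * (a * a)" .
      moreover have "a * a \<in> A * A - {a * b}"
        using assms by (auto intro: set_times_intro)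
      ultimately show ?thesis using assms by (auto intro: set_times_intro)
    qed
  qed
qed (simp add: set_times_mono2)

lemma cancellative_is_singleton:
  fixes P :: "'a::ab_semigroup_mult set set"
  assumes P: "downward_complete P" and A: "cancellative P A"
  obtains u where "A = {u}"
proof -
  have "A \<in> P" and inj: "inj_on (\<lambda>X. A * X) P"
    using A by (auto simp: cancellative_iff_left_cancellative left_cancellative_def)
  have square: "a * a = a * b" if "a \<in> A" "b \<in> A" for a b
  proof (rule ccontr)
    assume ne: "a * a \<noteq> a * b"
    have AA: "A * A \<in> P"
      using P \<open>A \<in> P\<close> by (simp add: downward_complete_times)
    have "a * a \<in> A * A - {a * b}"
      using ne that by (auto intro: set_times_intro)
    then have "A * A - {a * b} \<in> P"
      by (intro downward_complete_subset[OF P AA]) auto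
    then have "A * A - {a * b} = A * A"
      using inj_onD[OF inj times_Diff_singleton_eq[OF that ne]] AA by blast
    then show False
      using that by (auto intro: set_times_intro)
  qed
  have "a = b" if "a \<in> A" "b \<in> A" for a b
  proof -
    have "x * a = x * b" if "x \<in> A" for x
      using square[OF that \<open>a \<in> A\<close>] square[OF that \<open>b \<in> A\<close>] by simp
    then have "A * {a} = A * {b}"
      by (auto simp: set_times_def)
    then have "{a} = {b}"
      using inj_onD[OF inj] downward_complete_singleton[OF P] by blast
    then show "a = b" by simp
  qed
  with downward_complete_nonempty[OF P \<open>A \<in> P\<close>] that show thesis
    by blast
qed

lemma cancellative_singleton_iff:
  fixes P :: "'a::ab_semigroup_mult set set"
  assumes P: "downward_complete P"
  shows "cancellative P {u} \<longleftrightarrow> cancellative UNIV u"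
proof -
  have "inj_on (\<lambda>X. {u} * X) P \<longleftrightarrow> inj (\<lambda>x. u * x)"
  proof
    assume inj: "inj_on (\<lambda>X. {u} * X) P"
    show "inj (\<lambda>x. u * x)"
    proof (rule injI)
      fix x y assume "u * x = u * y"
      then have "{u} * {x} = {u} * {y}"
        by (simp add: singleton_times_eq_image)
      then have "{x} = {y}"
        using inj_onD[OF inj] downward_complete_singleton[OF P] by blast
      then show "x = y" by simp
    qed
  next
    assume "inj (\<lambda>x. u * x)"
    then show "inj_on (\<lambda>X. {u} * X) P"
      by (simp add: inj_on_def[of _ P] singleton_times_eq_image inj_image_eq_iff)
  qed
  then show ?thesis
    using downward_complete_singleton[OF P]
    by (simp add: cancellative_iff_left_cancellative left_cancellative_def)
qed

theorem proposition1:
  fixes P :: "'a::ab_semigroup_mult set set"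
  assumes "downward_complete P"
  shows "{A. cancellative P A} = {{u} | u. cancellative (UNIV :: 'a set) u}"
  using cancellative_is_singleton[OF assms] cancellative_singleton_iff[OF assms]
  by (smt (verit, best) Collect_cong)

end
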